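(* Let $\Delta^n=(\mathrm{Prop}_k,\mathrm{Nom}_k)_{k\in\{0,\dots,n\}}$ be a signature, let $M=(W^n,D^n,R^n,V^n)$ be an $n$-layered model over $\Delta^n$, let $k\in\{0,\dots,n\}$ and let $\varphi\in Fm_k(\Delta^n)$. Then for every $(w_0,\dots,w_k)\in D_k$, \[M_k,w_0,\dots,w_k\models_k\varphi \quad\text{iff}\quad \overline{M_k}\models \mathrm{ST}^k_{x_0,\dots,x_k}(\varphi),\] where $x_0,\dots,x_k$ are distinct variables of sorts $S_0,\dots,S_k$, $\overline{M_k}$ denotes the first-order structure $M^*_k$ together with the assignment $x_r\mapsto w_r$ ($r\in\{0,\dots,k\}$), and $\models$ on the right is ordinary many-sorted first-order satisfaction.
   Context: Notation. For $P\subseteq S_0\times\dots\times S_n$ and $k\le n$, $P|_k\subseteq S_0\times\dots\times S_k$ is the set of $(s_0,\dots,s_k)$ such that $(s_0,\dots,s_n)\in P$ for some $s_{k+1},\dots,s_n$. Signatures. An $n$-layered signature $\Delta^n=(\mathrm{Prop}_k,\mathrm{Nom}_k)_{k\in\{0,\dots,n\}}$ is a family of pairwise disjoint, possibly empty, sets; elements $p_k\in\mathrm{Prop}_k$ are propositions of level $k$, elements $i_k\in\mathrm{Nom}_k$ are nominals of level $k$. Formulas. Define simultaneously, for $k\in\{0,\dots,n\}$, the set $Fm_k(\Delta^n)$ of level-$k$ formulas and the set $B_k$ of basic level-$k$ formulas: - $Fm_0$: $i_0\mid p_0\mid\neg\varphi\mid\varphi\wedge\psi\mid @_{i_0}\varphi\mid\Diamond_0\varphi$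 (with $\varphi,\psi\in Fm_0$); $B_0$: $i_0\mid p_0\mid @_{i_0}\varphi\mid \Diamond_0\varphi$ with $\varphi\in Fm_0$. - For $k\ge1$, $Fm_k$: $\beta\mid i_k\mid p_k\mid\neg\varphi\mid\varphi\wedge\psi\mid @_{i_k}\varphi\mid\Diamond_k\varphi$ with $\beta\in B_{k-1}$ and $\varphi,\psi\in Fm_k$; and $B_k$: $i_k\mid p_k\mid\beta\mid @_{i_k}\varphi\mid\Diamond_k\varphi$ with $\beta\in B_{k-1}$, $\varphi\in Fm_k$. Here $i_k\in\mathrm{Nom}_k$, $p_k\in\mathrm{Prop}_k$. Models. An $n$-layered model $M=(W^n,D^n,R^n,V^n)$ over $\Delta^n$ consists of: a family $W^n=(W_k)_{k\le n}$ of pairwise disjoint sets; a predicate $D^n\subseteq W_0\times\dots\times W_n$ such that, writing $D_k=D^n|_k$, for each $k$, $W_k=\{v_k\mid (w_0,\dots,w_{k-1},v_k)\in D_k \text{ for some } (w_0,\dots,w_{k-1})\in D_{k-1}\}$; relations $R_k\subseteq D_k\times D_k$ for $k\le n$; and valuations $V^{\mathrm{Prop}}_0:\mathrm{Prop}_0\to\mathcal P(W_0)$, $V^{\mathrm{Prop}}_k:\mathrm{Prop}_k\times D_{k-1}\to\mathcal P(W_k)$ for $k\ge1$, and $V^{\mathrm{Nom}}_k:\mathrm{Nom}_k\to W_k$. The $k$-restriction $M_k$ keeps only the components of levels $\le k$ (with $D_k$ in place of $D^n$). Satisfaction. For $(w_0,\dots,w_k)\in D_k$ and $\varphi\in Fm_k$,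 $M_k,w_0,\dots,w_k\models_k\varphi$ is defined by: - $\beta\in B_{k-1}$ ($k\ge1$): iff $M_{k-1},w_0,\dots,w_{k-1}\models_{k-1}\beta$; - $p_k$: iff $w_0\in V^{\mathrm{Prop}}_0(p_0)$ when $k=0$, and iff $w_k\in V^{\mathrm{Prop}}_k(p_k,(w_0,\dots,w_{k-1}))$ when $k\ge1$; - $i_k$: iff $w_k=V^{\mathrm{Nom}}_k(i_k)$ and $(w_0,\dots,w_{k-1},V^{\mathrm{Nom}}_k(i_k))\in D_k$; - $\neg$, $\wedge$: as usual; - $@_{i_k}\varphi$: iff $(w_0,\dots,w_{k-1},V^{\mathrm{Nom}}_k(i_k))\in D_k$ and $M_k,w_0,\dots,w_{k-1},V^{\mathrm{Nom}}_k(i_k)\models_k\varphi$; - $\Diamond_k\varphi$: iff there is $(v_0,\dots,v_k)$ with $(w_0,\dots,w_k)R_k(v_0,\dots,v_k)$ and $M_k,v_0,\dots,v_k\models_k\varphi$. First-order translation. For $k\le n$, the many-sorted first-order signature $\Sigma^k$ has sorts $S_0,\dots,S_k$; for each $r\le k$ a constant $i_r$ of sort $S_r$ for each $i_r\in\mathrm{Nom}_r$, a predicate symbol $D_r$ of arity $S_0\cdots S_r$, a predicate symbol $p_r$ of arity $S_0\cdots S_r$ for each $p_r\in\mathrm{Prop}_r$, and a predicate symbol $R_r$ of arity $S_0\cdots S_rS_0\cdots S_r$. The $\Sigma^k$-structure $M^*_k$ interprets $S_r$ as $W_r$, $i_r$ as $V^{\mathrm{Nom}}_r(i_r)$, $D_r$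 as $D_r$, $R_r$ as $R_r$, $p_0$ as $V^{\mathrm{Prop}}_0(p_0)$, and for $r\ge1$, $p_r$ as $\{(w_0,\dots,w_r)\mid (w_0,\dots,w_{r-1})\in D_{r-1},\ w_r\in V^{\mathrm{Prop}}_r(p_r,(w_0,\dots,w_{r-1}))\}$. For $\varphi\in Fm_k$ and terms $t_0,\dots,t_k$ of sorts $S_0,\dots,S_k$ (variables or constants), $\mathrm{ST}^k_{t_0,\dots,t_k}(\varphi)$ is defined by: - $\mathrm{ST}^k_{t_0,\dots,t_k}(\beta)=\mathrm{ST}^{k-1}_{t_0,\dots,t_{k-1}}(\beta)$ for $\beta\in B_{k-1}$; - $\mathrm{ST}^k_{t_0,\dots,t_k}(p_k)=p_k(t_0,\dots,t_k)$; - $\mathrm{ST}^k_{t_0,\dots,t_k}(i_k)=(i_k=t_k)$; - $\mathrm{ST}^k_{t_0,\dots,t_k}(@_{i_k}\varphi)=D_k(t_0,\dots,t_{k-1},i_k)\wedge\mathrm{ST}^k_{t_0,\dots,t_{k-1},i_k}(\varphi)$; - $\mathrm{ST}^k_{t_0,\dots,t_k}(\Diamond_k\varphi)=\exists y_0\cdots\exists y_k\big(D_k(y_0,\dots,y_k)\wedge R_k(t_0,\dots,t_k,y_0,\dots,y_k)\wedge\mathrm{ST}^k_{y_0,\dots,y_k}(\varphi)\big)$ with fresh variables $y_r$ of sort $S_r$; - $\mathrm{ST}^k(\varphi\wedge\psi)=\mathrm{ST}^k(\varphi)\wedge\mathrm{ST}^k(\psi)$, $\mathrm{ST}^k(\neg\varphi)=\neg\mathrm{ST}^k(\varphi)$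 (same subscripts). *)

theory Defs
  imports Main
begin

section \<open>Many-sorted first-order logic with equality\<close>

text \<open>Terms are sorted variables (a sort and an index) or constants; this relational fragment has
  no proper function symbols. Existential quantification, negation and conjunction are primitive.\<close>

type_synonym 'so var = "'so \<times> nat"

datatype ('so, 'c) tm = TVar "'so var" | TConst 'c

datatype ('so, 'c, 'r) fo =
    Eq "('so, 'c) tm" "('so, 'c) tm"
  | Pred 'r "('so, 'c) tm list"
  | FNot "('so, 'c, 'r) fo"
  | FAnd "('so, 'c, 'r) fo" "('so, 'c, 'r) fo"
  | FEx "'so var" "('so, 'c, 'r) fo"

record ('so, 'c, 'r) fo_sig =
  Sorts :: "'so set"
  ConstSyms :: "'so \<Rightarrow> 'c set"
  PredSyms :: "'so list \<Rightarrow> 'r set"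

record ('so, 'c, 'r, 'w) fo_struct =
  Carrier :: "'so \<Rightarrow> 'w set"
  ConstInt :: "'c \<Rightarrow> 'w"
  PredInt :: "'r \<Rightarrow> 'w list set"

definition fo_structure ::
    "('so, 'c, 'r) fo_sig \<Rightarrow> ('so, 'c, 'r, 'w) fo_struct \<Rightarrow> bool" where
  "fo_structure \<Sigma> \<AA> \<longleftrightarrow>
     (\<forall>s\<in>Sorts \<Sigma>. \<forall>c\<in>ConstSyms \<Sigma> s. ConstInt \<AA> c \<in> Carrier \<AA> s) \<and>
     (\<forall>ar\<in>lists (Sorts \<Sigma>). \<forall>r\<in>PredSyms \<Sigma> ar.
        PredInt \<AA> r \<subseteq> {as. list_all2 (\<lambda>a s. a \<in> Carrier \<AA> s) as ar})"

fun wf_tm :: "('so, 'c, 'r) fo_sig \<Rightarrow> ('so, 'c) tm \<Rightarrow> 'so \<Rightarrow> bool" where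
  "wf_tm \<Sigma> (TVar x) s \<longleftrightarrow> s \<in> Sorts \<Sigma> \<and> fst x = s"
| "wf_tm \<Sigma> (TConst c) s \<longleftrightarrow> s \<in> Sorts \<Sigma> \<and> c \<in> ConstSyms \<Sigma> s"

fun wf_fo :: "('so, 'c, 'r) fo_sig \<Rightarrow> ('so, 'c, 'r) fo \<Rightarrow> bool" where
  "wf_fo \<Sigma> (Eq t u) \<longleftrightarrow> (\<exists>s. wf_tm \<Sigma> t s \<and> wf_tm \<Sigma> u s)"
| "wf_fo \<Sigma> (Pred r ts) \<longleftrightarrow> (\<exists>ar. r \<in> PredSyms \<Sigma> ar \<and> list_all2 (wf_tm \<Sigma>) ts ar)"
| "wf_fo \<Sigma> (FNot \<phi>) \<longleftrightarrow> wf_fo \<Sigma> \<phi>"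
| "wf_fo \<Sigma> (FAnd \<phi> \<psi>) \<longleftrightarrow> wf_fo \<Sigma> \<phi> \<and> wf_fo \<Sigma> \<psi>"
| "wf_fo \<Sigma> (FEx x \<phi>) \<longleftrightarrow> fst x \<in> Sorts \<Sigma> \<and> wf_fo \<Sigma> \<phi>"

definition fo_assignment ::
    "('so, 'c, 'r) fo_sig \<Rightarrow> ('so, 'c, 'r, 'w) fo_struct \<Rightarrow> ('so var \<Rightarrow> 'w) \<Rightarrow> bool" where
  "fo_assignment \<Sigma> \<AA> e \<longleftrightarrow> (\<forall>x. fst x \<in> Sorts \<Sigma> \<longrightarrow> e x \<in> Carrier \<AA> (fst x))"

fun tm_val :: "('so, 'c, 'r, 'w) fo_struct \<Rightarrow> ('so var \<Rightarrow> 'w) \<Rightarrow> ('so, 'c) tm \<Rightarrow> 'w" where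
  "tm_val \<AA> e (TVar x) = e x"
| "tm_val \<AA> e (TConst c) = ConstInt \<AA> c"

fun fo_sat :: "('so, 'c, 'r, 'w) fo_struct \<Rightarrow> ('so var \<Rightarrow> 'w) \<Rightarrow> ('so, 'c, 'r) fo \<Rightarrow> bool" where
  "fo_sat \<AA> e (Eq t u) \<longleftrightarrow> tm_val \<AA> e t = tm_val \<AA> e u"
| "fo_sat \<AA> e (Pred r ts) \<longleftrightarrow> map (tm_val \<AA> e) ts \<in> PredInt \<AA> r"
| "fo_sat \<AA> e (FNot \<phi>) \<longleftrightarrow> \<not> fo_sat \<AA> e \<phi>"
| "fo_sat \<AA> e (FAnd \<phi> \<psi>) \<longleftrightarrow> fo_sat \<AA> e \<phi> \<and> fo_sat \<AA> e \<psi>"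
| "fo_sat \<AA> e (FEx x \<phi>) \<longleftrightarrow> (\<exists>a\<in>Carrier \<AA> (fst x). fo_sat \<AA> (e(x := a)) \<phi>)"


section \<open>Layered signatures and formulas\<close>

text \<open>Only the components at levels \<open>0, \<dots>, n\<close> of an \<open>n\<close>-layered signature are meaningful; the
  same convention applies to \<open>n\<close>-layered models below.\<close>

record 's lsig =
  Props :: "nat \<Rightarrow> 's set"
  Noms :: "nat \<Rightarrow> 's set"

definition layered_signature :: "nat \<Rightarrow> 's lsig \<Rightarrow> bool" where
  "layered_signature n \<Delta> \<longleftrightarrow>
     (\<forall>j\<le>n. \<forall>k\<le>n. Props \<Delta> j \<inter> Noms \<Delta> k = {}) \<and>
     (\<forall>j\<le>n. \<forall>k\<le>n. j \<noteq> k \<longrightarrow> Props \<Delta> j \<inter> Props \<Delta> k = {} \<and> Noms \<Delta> j \<inter> Noms \<Delta> k = {})"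

text \<open>Raw formulas: \<open>Dia k\<close> is the modality of level \<open>k\<close>, while the level of a symbol is
  the index of the set of the signature to which it belongs.\<close>

datatype 's lfm =
    Nom 's
  | Prp 's
  | Neg "'s lfm"
  | Conj "'s lfm" "'s lfm"
  | At 's "'s lfm"
  | Dia nat "'s lfm"

text \<open>\<open>fm \<Delta> k \<phi>\<close> is \<open>\<phi> \<in> Fm\<^sub>k(\<Delta>)\<close> and \<open>basic \<Delta> k \<phi>\<close> is \<open>\<phi> \<in> B\<^sub>k\<close>.\<close>

inductive fm :: "'s lsig \<Rightarrow> nat \<Rightarrow> 's lfm \<Rightarrow> bool"
  and basic :: "'s lsig \<Rightarrow> nat \<Rightarrow> 's lfm \<Rightarrow> bool"
  for \<Delta> :: "'s lsig" where
  fm_Nom: "i \<in> Noms \<Delta> k \<Longrightarrow> fm \<Delta> k (Nom i)"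
| fm_Prp: "p \<in> Props \<Delta> k \<Longrightarrow> fm \<Delta> k (Prp p)"
| fm_Neg: "fm \<Delta> k \<phi> \<Longrightarrow> fm \<Delta> k (Neg \<phi>)"
| fm_Conj: "fm \<Delta> k \<phi> \<Longrightarrow> fm \<Delta> k \<psi> \<Longrightarrow> fm \<Delta> k (Conj \<phi> \<psi>)"
| fm_At: "i \<in> Noms \<Delta> k \<Longrightarrow> fm \<Delta> k \<phi> \<Longrightarrow> fm \<Delta> k (At i \<phi>)"
| fm_Dia: "fm \<Delta> k \<phi> \<Longrightarrow> fm \<Delta> k (Dia k \<phi>)"
| fm_basic: "basic \<Delta> k \<beta> \<Longrightarrow> fm \<Delta> (Suc k) \<beta>"
| basic_Nom: "i \<in> Noms \<Delta> k \<Longrightarrow> basic \<Delta> k (Nom i)"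
| basic_Prp: "p \<in> Props \<Delta> k \<Longrightarrow> basic \<Delta> k (Prp p)"
| basic_At: "i \<in> Noms \<Delta> k \<Longrightarrow> fm \<Delta> k \<phi> \<Longrightarrow> basic \<Delta> k (At i \<phi>)"
| basic_Dia: "fm \<Delta> k \<phi> \<Longrightarrow> basic \<Delta> k (Dia k \<phi>)"
| basic_basic: "basic \<Delta> k \<beta> \<Longrightarrow> basic \<Delta> (Suc k) \<beta>"


section \<open>Layered models and satisfaction\<close>

text \<open>A tuple \<open>(w\<^sub>0, \<dots>, w\<^sub>k)\<close> is a list of length \<open>Suc k\<close>. The valuation of propositions takes
  the tuple \<open>(w\<^sub>0, \<dots>, w\<^sub>k\<^sub>-\<^sub>1)\<close> as an argument, which at level \<open>0\<close> is the empty list.\<close>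

record ('s, 'w) lmodel =
  Wld :: "nat \<Rightarrow> 'w set"
  Dom :: "'w list set"
  Rel :: "nat \<Rightarrow> ('w list \<times> 'w list) set"
  ValP :: "nat \<Rightarrow> 's \<Rightarrow> 'w list \<Rightarrow> 'w set"
  ValN :: "nat \<Rightarrow> 's \<Rightarrow> 'w"

definition restr :: "'w list set \<Rightarrow> nat \<Rightarrow> 'w list set" where
  "restr P k = take (Suc k) ` P"

definition Dk :: "('s, 'w) lmodel \<Rightarrow> nat \<Rightarrow> 'w list set" where
  "Dk M k = restr (Dom M) k"

text \<open>\<open>D\<^sub>k\<^sub>-\<^sub>1\<close>, where \<open>D\<^sub>-\<^sub>1\<close> consists of the empty tuple.\<close>

definition Dpred :: "('s, 'w) lmodel \<Rightarrow> nat \<Rightarrow> 'w list set" where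
  "Dpred M k = (if k = 0 then {[]} else Dk M (k - 1))"

definition layered_model :: "nat \<Rightarrow> 's lsig \<Rightarrow> ('s, 'w) lmodel \<Rightarrow> bool" where
  "layered_model n \<Delta> M \<longleftrightarrow>
     (\<forall>j\<le>n. \<forall>k\<le>n. j \<noteq> k \<longrightarrow> Wld M j \<inter> Wld M k = {}) \<and>
     Dom M \<subseteq> {ws. length ws = Suc n \<and> (\<forall>k\<le>n. ws ! k \<in> Wld M k)} \<and>
     (\<forall>k\<le>n. Wld M k = {v. \<exists>ws\<in>Dpred M k. ws @ [v] \<in> Dk M k}) \<and>
     (\<forall>k\<le>n. Rel M k \<subseteq> Dk M k \<times> Dk M k) \<and>
     (\<forall>k\<le>n. \<forall>p\<in>Props \<Delta> k. \<forall>ws\<in>Dpred M k. ValP M k p ws \<subseteq> Wld M k) \<and>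
     (\<forall>k\<le>n. \<forall>i\<in>Noms \<Delta> k. ValN M k i \<in> Wld M k)"

definition restrict_model :: "('s, 'w) lmodel \<Rightarrow> nat \<Rightarrow> ('s, 'w) lmodel" where
  "restrict_model M k =
     \<lparr> Wld = (\<lambda>j. if j \<le> k then Wld M j else {}),
       Dom = Dk M k,
       Rel = (\<lambda>j. if j \<le> k then Rel M j else {}),
       ValP = (\<lambda>j. if j \<le> k then ValP M j else (\<lambda>p ws. {})),
       ValN = (\<lambda>j. if j \<le> k then ValN M j else undefined) \<rparr>"

text \<open>\<open>sat \<Delta> k N ws \<phi>\<close> is \<open>N, w\<^sub>0, \<dots>, w\<^sub>k \<Turnstile>\<^sub>k \<phi>\<close> for a \<open>k\<close>-layered model \<open>N\<close> and \<open>\<phi> \<in> Fm\<^sub>k(\<Delta>)\<close>.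
  If \<open>\<phi>\<close> is not in \<open>B\<^sub>k\<^sub>-\<^sub>1\<close>, then all symbols at its head have level \<open>k\<close>.\<close>

function sat :: "'s lsig \<Rightarrow> nat \<Rightarrow> ('s, 'w) lmodel \<Rightarrow> 'w list \<Rightarrow> 's lfm \<Rightarrow> bool" where
  "sat \<Delta> k N ws \<phi> =
     (if 0 < k \<and> basic \<Delta> (k - 1) \<phi>
      then sat \<Delta> (k - 1) (restrict_model N (k - 1)) (butlast ws) \<phi>
      else case \<phi> of
        Prp p \<Rightarrow> last ws \<in> ValP N k p (butlast ws)
      | Nom i \<Rightarrow> last ws = ValN N k i \<and> butlast ws @ [ValN N k i] \<in> Dk N k
      | Neg \<psi> \<Rightarrow> \<not> sat \<Delta> k N ws \<psi>
      | Conj \<psi> \<chi> \<Rightarrow> sat \<Delta> k N ws \<psi> \<and> sat \<Delta> k N ws \<chi>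
      | At i \<psi> \<Rightarrow> butlast ws @ [ValN N k i] \<in> Dk N k \<and>
                  sat \<Delta> k N (butlast ws @ [ValN N k i]) \<psi>
      | Dia j \<psi> \<Rightarrow> (\<exists>vs. (ws, vs) \<in> Rel N k \<and> sat \<Delta> k N vs \<psi>))"
  by pat_completeness auto
termination
  by (relation "measures [\<lambda>(\<Delta>, k, N, ws, \<phi>). size \<phi>, \<lambda>(\<Delta>, k, N, ws, \<phi>). k]") auto

declare sat.simps [simp del]


section \<open>The first-order signature, structure and translation\<close>

text \<open>The sort \<open>S\<^sub>r\<close> is the number \<open>r\<close>, and the constant symbol of a nominal \<open>i\<close> of level \<open>r\<close> is
  the pair \<open>(r, i)\<close>.\<close>

datatype 's psym = SymD nat | SymR nat | SymP nat 's

type_synonym 's lfo = "(nat, nat \<times> 's, 's psym) fo"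

definition Sigma_sig :: "'s lsig \<Rightarrow> nat \<Rightarrow> (nat, nat \<times> 's, 's psym) fo_sig" where
  "Sigma_sig \<Delta> k =
     \<lparr> Sorts = {..k},
       ConstSyms = (\<lambda>r. {(r, i) | i. r \<le> k \<and> i \<in> Noms \<Delta> r}),
       PredSyms = (\<lambda>ar. {SymD r | r. r \<le> k \<and> ar = [0..<Suc r]} \<union>
                        {SymR r | r. r \<le> k \<and> ar = [0..<Suc r] @ [0..<Suc r]} \<union>
                        {SymP r p | r p. r \<le> k \<and> p \<in> Props \<Delta> r \<and> ar = [0..<Suc r]}) \<rparr>"

fun star_pred :: "('s, 'w) lmodel \<Rightarrow> 's psym \<Rightarrow> 'w list set" where
  "star_pred N (SymD r) = Dk N r"
| "star_pred N (SymR r) = {us @ vs | us vs. (us, vs) \<in> Rel N r}"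
| "star_pred N (SymP r p) = {ws @ [w] | ws w. ws \<in> Dpred N r \<and> w \<in> ValP N r p ws}"

definition star :: "('s, 'w) lmodel \<Rightarrow> (nat, nat \<times> 's, 's psym, 'w) fo_struct" where
  "star N = \<lparr> Carrier = Wld N, ConstInt = (\<lambda>(r, i). ValN N r i), PredInt = star_pred N \<rparr>"

text \<open>A variable of sort \<open>r\<close> not occurring among the terms \<open>ts\<close>.\<close>

definition fresh :: "(nat, 'c) tm list \<Rightarrow> nat \<Rightarrow> nat var" where
  "fresh ts r = (r, LEAST m. TVar (r, m) \<notin> set ts)"

function ST :: "'s lsig \<Rightarrow> nat \<Rightarrow> (nat, nat \<times> 's) tm list \<Rightarrow> 's lfm \<Rightarrow> 's lfo" where
  "ST \<Delta> k ts \<phi> =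
     (if 0 < k \<and> basic \<Delta> (k - 1) \<phi>
      then ST \<Delta> (k - 1) (butlast ts) \<phi>
      else case \<phi> of
        Prp p \<Rightarrow> Pred (SymP k p) ts
      | Nom i \<Rightarrow> Eq (TConst (k, i)) (last ts)
      | Neg \<psi> \<Rightarrow> FNot (ST \<Delta> k ts \<psi>)
      | Conj \<psi> \<chi> \<Rightarrow> FAnd (ST \<Delta> k ts \<psi>) (ST \<Delta> k ts \<chi>)
      | At i \<psi> \<Rightarrow> (let us = butlast ts @ [TConst (k, i)]
                  in FAnd (Pred (SymD k) us) (ST \<Delta> k us \<psi>))
      | Dia j \<psi> \<Rightarrow> (let ys = map (fresh ts) [0..<Suc k]; us = map TVar ys
                  in foldr FEx ys
                       (FAnd (Pred (SymD k) us)
                             (FAnd (Pred (SymR k) (ts @ us)) (ST \<Delta> k us \<psi>)))))"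
  by pat_completeness auto
termination
  by (relation "measures [\<lambda>(\<Delta>, k, ts, \<phi>). size \<phi>, \<lambda>(\<Delta>, k, ts, \<phi>). k]") auto

declare ST.simps [simp del]


text \<open>Well-formedness: \<open>M\<^sub>k\<^sup>*\<close> is a structure over, and translations are formulas of, the
  signature \<open>\<Sigma>\<^sup>k\<close>.\<close>

lemma Dk_restrict_model: "r \<le> k \<Longrightarrow> Dk (restrict_model M k) r = Dk M r"
  by (auto simp: Dk_def restr_def restrict_model_def image_image min_def)

lemma Dpred_restrict_model: "r \<le> k \<Longrightarrow> Dpred (restrict_model M k) r = Dpred M r"
  by (auto simp: Dpred_def Dk_restrict_model)

lemma Dk_in_carriers:
  assumes "layered_model n \<Delta> M" "r \<le> n" "ws \<in> Dk M r"
  shows "list_all2 (\<lambda>a s. a \<in> Wld M s) ws [0..<Suc r]"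
proof -
  obtain us where us: "us \<in> Dom M" "ws = take (Suc r) us"
    using assms(3) by (auto simp: Dk_def restr_def)
  have "length us = Suc n" "\<forall>k\<le>n. us ! k \<in> Wld M k"
    using us(1) assms(1) by (auto simp: layered_model_def)
  then show ?thesis
    using us(2) assms(2) by (auto simp: list_all2_conv_all_nth nth_append simp del: upt_Suc)
qed

lemma Dpred_in_carriers:
  assumes "layered_model n \<Delta> M" "r \<le> n" "ws \<in> Dpred M r"
  shows "list_all2 (\<lambda>a s. a \<in> Wld M s) ws [0..<r]"
  using assms Dk_in_carriers[of n \<Delta> M "r - 1" ws] by (cases r) (auto simp: Dpred_def)

lemma fo_structure_star:
  assumes M: "layered_model n \<Delta> M" and "k \<le> n"
  shows "fo_structure (Sigma_sig \<Delta> k) (star (restrict_model M k))"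
proof -
  let ?N = "restrict_model M k"
  have mono: "list_all2 (\<lambda>a s. a \<in> Wld ?N s) as [0..<j]"
    if "list_all2 (\<lambda>a s. a \<in> Wld M s) as [0..<j]" "j \<le> Suc k" for as j
    using that by (auto simp: list_all2_conv_all_nth restrict_model_def)
  have D: "list_all2 (\<lambda>a s. a \<in> Wld ?N s) as [0..<Suc r]" if "as \<in> Dk M r" "r \<le> k" for as r
    using mono[OF Dk_in_carriers[OF M _ that(1)]] that(2) assms(2) by simp
  have Rel: "\<forall>k\<le>n. Rel M k \<subseteq> Dk M k \<times> Dk M k"
    and Val: "\<forall>k\<le>n. \<forall>p\<in>Props \<Delta> k. \<forall>ws\<in>Dpred M k. ValP M k p ws \<subseteq> Wld M k"
    using M unfolding layered_model_def by blast+
  have R: "list_all2 (\<lambda>a s. a \<in> Wld ?N s) (us @ vs) ([0..<Suc r] @ [0..<Suc r])"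
    if "(us, vs) \<in> Rel M r" "r \<le> k" for us vs r
  proof -
    have "us \<in> Dk M r" "vs \<in> Dk M r"
      using Rel that assms(2) by (meson le_trans mem_Sigma_iff subsetD)+
    then show ?thesis
      using D that(2) by (intro list_all2_appendI) auto
  qed
  have P: "list_all2 (\<lambda>a s. a \<in> Wld ?N s) (ws @ [w]) [0..<Suc r]"
    if "p \<in> Props \<Delta> r" "ws \<in> Dpred M r" "w \<in> ValP M r p ws" "r \<le> k" for p ws w r
  proof -
    have "w \<in> Wld M r"
      using Val that assms(2) by (meson le_trans subsetD)
    then have "list_all2 (\<lambda>a s. a \<in> Wld ?N s) (ws @ [w]) ([0..<r] @ [r])"
      using mono[OF Dpred_in_carriers[OF M _ that(2)]] that(4) assms(2)
      by (intro list_all2_appendI) (auto simp: restrict_model_def)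
    then show ?thesis by simp
  qed
  have C: "ValN M r i \<in> Wld M r" if "i \<in> Noms \<Delta> r" "r \<le> k" for i r
    using that M assms(2) by (auto simp: layered_model_def)
  have PI: "PredInt (star ?N) (SymD r) = Dk M r"
    "PredInt (star ?N) (SymR r) = {us @ vs | us vs. (us, vs) \<in> Rel M r}"
    "PredInt (star ?N) (SymP r p) = {ws @ [w] | ws w. ws \<in> Dpred M r \<and> w \<in> ValP M r p ws}"
    if "r \<le> k" for r p
    using that Dk_restrict_model[OF that, of M] Dpred_restrict_model[OF that, of M]
    by (auto simp: star_def restrict_model_def)
  have CI: "ConstInt (star ?N) (r, i) = ValN M r i" "Carrier (star ?N) r = Wld M r"
    if "r \<le> k" for r i
    using that by (auto simp: star_def restrict_model_def)
  have CN: "Carrier (star ?N) = Wld ?N"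
    by (simp add: star_def)
  have "list_all2 (\<lambda>a s. a \<in> Carrier (star ?N) s) as ar"
    if q: "q \<in> PredSyms (Sigma_sig \<Delta> k) ar" and as: "as \<in> PredInt (star ?N) q" for q ar as
  proof -
    consider (d) r where "r \<le> k" "q = SymD r" "ar = [0..<Suc r]"
      | (r) r where "r \<le> k" "q = SymR r" "ar = [0..<Suc r] @ [0..<Suc r]"
      | (p) r p where "r \<le> k" "q = SymP r p" "p \<in> Props \<Delta> r" "ar = [0..<Suc r]"
      using q by (auto simp: Sigma_sig_def simp del: upt_Suc)
    then show ?thesis
    proof cases
      case d
      then show ?thesis using D as PI(1) CN by metis
    next
      case r
      then obtain us vs where "as = us @ vs" "(us, vs) \<in> Rel M r"
        using as PI(2)[OF r(1)] by blast
      then show ?thesis using R r CN by metis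
    next
      case p
      then obtain ws w where "as = ws @ [w]" "ws \<in> Dpred M r" "w \<in> ValP M r p ws"
        using as PI(3)[OF p(1)] by blast
      then show ?thesis using P p CN by metis
    qed
  qed
  moreover have "ConstInt (star ?N) c \<in> Carrier (star ?N) s"
    if "s \<in> Sorts (Sigma_sig \<Delta> k)" "c \<in> ConstSyms (Sigma_sig \<Delta> k) s" for c s
    using that by (auto simp: Sigma_sig_def CI C)
  ultimately show ?thesis
    by (auto simp: fo_structure_def)
qed

lemma wf_tm_mono: "wf_tm (Sigma_sig \<Delta> j) t r \<Longrightarrow> j \<le> k \<Longrightarrow> wf_tm (Sigma_sig \<Delta> k) t r"
  by (cases t) (auto simp: Sigma_sig_def)

lemma wf_tm_lower: "wf_tm (Sigma_sig \<Delta> k) t r \<Longrightarrow> r \<le> j \<Longrightarrow> wf_tm (Sigma_sig \<Delta> j) t r"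
  by (cases t) (auto simp: Sigma_sig_def)

lemma wf_fo_mono:
  "wf_fo (Sigma_sig \<Delta> j) \<phi> \<Longrightarrow> j \<le> k \<Longrightarrow> wf_fo (Sigma_sig \<Delta> k) \<phi>"
proof (induction \<phi>)
  case (Eq t u)
  then show ?case by (auto intro: wf_tm_mono)
next
  case (Pred q ts)
  then obtain ar where ar: "q \<in> PredSyms (Sigma_sig \<Delta> j) ar" "list_all2 (wf_tm (Sigma_sig \<Delta> j)) ts ar"
    by auto
  have "list_all2 (wf_tm (Sigma_sig \<Delta> k)) ts ar"
    using ar(2) Pred.prems(2) by (auto elim!: list_all2_mono intro: wf_tm_mono)
  moreover have "q \<in> PredSyms (Sigma_sig \<Delta> k) ar"
    using ar(1) Pred.prems(2) by (auto simp: Sigma_sig_def)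
  ultimately show ?case by auto
qed (auto simp: Sigma_sig_def)

lemma wf_fo_foldr_FEx:
  "wf_fo \<Sigma> (foldr FEx ys \<phi>) \<longleftrightarrow> (\<forall>y\<in>set ys. fst y \<in> Sorts \<Sigma>) \<and> wf_fo \<Sigma> \<phi>"
  by (induction ys) auto

lemma fm_not_basic_cases:
  assumes "fm \<Delta> k \<phi>" "\<not> (0 < k \<and> basic \<Delta> (k - 1) \<phi>)"
  shows "case \<phi> of Nom i \<Rightarrow> i \<in> Noms \<Delta> k | Prp p \<Rightarrow> p \<in> Props \<Delta> k | Neg \<psi> \<Rightarrow> fm \<Delta> k \<psi>
    | Conj \<psi> \<chi> \<Rightarrow> fm \<Delta> k \<psi> \<and> fm \<Delta> k \<chi> | At i \<psi> \<Rightarrow> i \<in> Noms \<Delta> k \<and> fm \<Delta> k \<psi>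
    | Dia j \<psi> \<Rightarrow> j = k \<and> fm \<Delta> k \<psi>"
  using assms by (cases rule: fm.cases) auto

lemma basic_imp_fm: "basic \<Delta> k \<phi> \<Longrightarrow> fm \<Delta> k \<phi>"
  by (erule basic.cases) (auto intro: fm_basic.intros)

lemma wf_ST:
  assumes "fm \<Delta> k \<phi>" "list_all2 (wf_tm (Sigma_sig \<Delta> k)) ts [0..<Suc k]"
  shows "wf_fo (Sigma_sig \<Delta> k) (ST \<Delta> k ts \<phi>)"
  using assms
proof (induction \<Delta> k ts \<phi> rule: ST.induct)
  case (1 \<Delta> k ts \<phi>)
  show ?case
  proof (cases "0 < k \<and> basic \<Delta> (k - 1) \<phi>")
    case True
    then obtain j where j: "k = Suc j" by (cases k) auto
    have "list_all2 (wf_tm (Sigma_sig \<Delta> k)) (butlast ts) [0..<Suc j]"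
      using 1(8) unfolding j
      by (auto simp: list_all2_conv_all_nth nth_butlast nth_append simp del: upt_Suc)
    then have "list_all2 (wf_tm (Sigma_sig \<Delta> j)) (butlast ts) [0..<Suc j]"
      by (auto simp: list_all2_conv_all_nth simp del: upt_Suc)
        (metis wf_tm_lower less_Suc_eq_le)
    then have "wf_fo (Sigma_sig \<Delta> j) (ST \<Delta> j (butlast ts) \<phi>)"
      using 1(1)[OF True] True j by (auto intro: basic_imp_fm)
    then show ?thesis
      using True j by (subst ST.simps) (auto intro: wf_fo_mono)
  next
    case False
    have lev: "case \<phi> of Nom i \<Rightarrow> i \<in> Noms \<Delta> k | Prp p \<Rightarrow> p \<in> Props \<Delta> k
      | Neg \<psi> \<Rightarrow> fm \<Delta> k \<psi> | Conj \<psi> \<chi> \<Rightarrow> fm \<Delta> k \<psi> \<and> fm \<Delta> k \<chi>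
      | At i \<psi> \<Rightarrow> i \<in> Noms \<Delta> k \<and> fm \<Delta> k \<psi> | Dia j \<psi> \<Rightarrow> j = k \<and> fm \<Delta> k \<psi>"
      using fm_not_basic_cases[OF 1(7) False] .
    have len: "length ts = Suc k"
      using list_all2_lengthD[OF 1(8)] by simp
    have wf: "wf_tm (Sigma_sig \<Delta> k) (ts ! r) r" if "r \<le> k" for r
      using list_all2_nthD2[OF 1(8), of r] that by (simp del: upt_Suc)
    show ?thesis
    proof (cases \<phi>)
      case (Nom i)
      then have "wf_tm (Sigma_sig \<Delta> k) (TConst (k, i)) k"
        using lev by (simp add: Sigma_sig_def)
      moreover have "wf_tm (Sigma_sig \<Delta> k) (last ts) k"
        using wf[of k] len by (simp add: last_conv_nth flip: length_0_conv)
      ultimately show ?thesis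
        using False Nom by (subst ST.simps) auto
    next
      case (Prp p)
      then have "SymP k p \<in> PredSyms (Sigma_sig \<Delta> k) [0..<Suc k]"
        using lev by (simp add: Sigma_sig_def)
      then show ?thesis
        using False Prp 1(8) by (subst ST.simps) auto
    next
      case (Neg \<psi>)
      have "wf_fo (Sigma_sig \<Delta> k) (ST \<Delta> k ts \<psi>)"
        using 1(2)[OF False Neg _ 1(8)] lev Neg by simp
      then show ?thesis
        using False Neg by (subst ST.simps) auto
    next
      case (Conj \<psi> \<chi>)
      have "wf_fo (Sigma_sig \<Delta> k) (ST \<Delta> k ts \<psi>)" "wf_fo (Sigma_sig \<Delta> k) (ST \<Delta> k ts \<chi>)"
        using 1(3)[OF False Conj _ 1(8)] 1(4)[OF False Conj _ 1(8)] lev Conj by simp_all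
      then show ?thesis
        using False Conj by (subst ST.simps) auto
    next
      case (At i \<psi>)
      let ?us = "butlast ts @ [TConst (k, i)]"
      have us: "list_all2 (wf_tm (Sigma_sig \<Delta> k)) ?us [0..<Suc k]"
        using lev At len wf
        by (auto simp: list_all2_conv_all_nth nth_append nth_butlast Sigma_sig_def less_Suc_eq
            simp del: upt_Suc)
      have "wf_fo (Sigma_sig \<Delta> k) (ST \<Delta> k ?us \<psi>)"
        using 1(5)[OF False At refl _ us] lev At by simp
      moreover have "SymD k \<in> PredSyms (Sigma_sig \<Delta> k) [0..<Suc k]"
        by (simp add: Sigma_sig_def)
      ultimately show ?thesis
        using False At us by (subst ST.simps) (auto simp: Let_def simp del: upt_Suc)
    next
      case (Dia j \<psi>)
      let ?ys = "map (fresh ts) [0..<Suc k]"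
      let ?us = "map TVar ?ys"
      have us: "list_all2 (wf_tm (Sigma_sig \<Delta> k)) ?us [0..<Suc k]"
        by (auto simp: list_all2_conv_all_nth Sigma_sig_def fresh_def simp del: upt_Suc)
      have "wf_fo (Sigma_sig \<Delta> k) (ST \<Delta> k ?us \<psi>)"
        using 1(6)[OF False Dia refl refl _ us] lev Dia by simp
      moreover have "SymD k \<in> PredSyms (Sigma_sig \<Delta> k) [0..<Suc k]"
        "SymR k \<in> PredSyms (Sigma_sig \<Delta> k) ([0..<Suc k] @ [0..<Suc k])"
        by (simp_all add: Sigma_sig_def)
      moreover have "list_all2 (wf_tm (Sigma_sig \<Delta> k)) (ts @ ?us) ([0..<Suc k] @ [0..<Suc k])"
        by (rule list_all2_appendI[OF 1(8) us])
      moreover have "\<forall>y\<in>set ?ys. fst y \<in> Sorts (Sigma_sig \<Delta> k)"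
        by (auto simp: fresh_def Sigma_sig_def)
      ultimately have "wf_fo (Sigma_sig \<Delta> k) (foldr FEx ?ys (FAnd (Pred (SymD k) ?us)
          (FAnd (Pred (SymR k) (ts @ ?us)) (ST \<Delta> k ?us \<psi>))))"
        using us unfolding wf_fo_foldr_FEx wf_fo.simps by blast
      then show ?thesis
        using False Dia by (subst ST.simps) (simp only: Let_def lfm.case if_False)
    qed
  qed
qed

end

theory Submission
  imports Defs
begin

text \<open>The translation writes out the satisfaction clauses in first-order form, so the claim
  follows by induction along the recursion of \<open>ST\<close> (formula size, then level). The
  induction needs arbitrary terms, since \<open>At\<close> puts a constant in last place, and a
  fixed structure of level \<open>K\<close>, since descending to a basic formula drops the last term
  but leaves the structure alone. Below \<open>K\<close> the structure agrees with \<open>M\<close>,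
  and \<open>restrict_model_restrict_model\<close> handles the repeated restriction on the modal
  side. The substantial case is \<open>Dia\<close>. By \<open>fo_sat_foldr_FEx\<close> the
  quantifier block chooses a new assignment of the variables \<open>fresh ts r\<close>; by
  \<open>fresh_notin\<close> this keeps the values of \<open>ts\<close>. There is one such variable
  of each sort, so assignments correspond to tuples, and \<open>Rel M k\<close> relates only tuples
  of \<open>Dk M k\<close>, as the induction hypothesis demands.\<close>

lemma fo_sat_foldr_FEx:
  "fo_sat \<AA> e (foldr FEx ys \<phi>) \<longleftrightarrow>
    (\<exists>e'. (\<forall>x. x \<notin> set ys \<longrightarrow> e' x = e x) \<and> (\<forall>y\<in>set ys. e' y \<in> Carrier \<AA> (fst y)) \<and>
      fo_sat \<AA> e' \<phi>)"
proof (induction ys arbitrary: e)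
  case Nil
  have "e' = e" if "\<forall>x. e' x = e x" for e'
    using that ext[of e' e] by blast
  then show ?case by auto
next
  case (Cons y ys)
  show ?case (is "?L \<longleftrightarrow> ?R")
  proof
    assume ?L
    then obtain a e' where "a \<in> Carrier \<AA> (fst y)"
      "\<forall>x. x \<notin> set ys \<longrightarrow> e' x = (e(y := a)) x" "\<forall>z\<in>set ys. e' z \<in> Carrier \<AA> (fst z)"
      "fo_sat \<AA> e' \<phi>"
      using Cons.IH by auto
    \<comment> \<open>If \<open>y\<close> recurs in \<open>ys\<close>, its value is controlled by
      the induction hypothesis; otherwise it is \<open>a\<close>.\<close>
    moreover from this have "e' y \<in> Carrier \<AA> (fst y)"
      by (metis fun_upd_same)
    ultimately show ?R
      by (intro exI[of _ e']) simp
  next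
    assume ?R
    then obtain e' where e': "\<forall>x. x \<notin> set (y # ys) \<longrightarrow> e' x = e x"
      "\<forall>z\<in>set (y # ys). e' z \<in> Carrier \<AA> (fst z)" "fo_sat \<AA> e' \<phi>"
      by blast
    have "fo_sat \<AA> (e(y := e' y)) (foldr FEx ys \<phi>)"
      unfolding Cons.IH using e' by (intro exI[of _ e']) auto
    then show ?L
      using e'(2) by auto
  qed
qed

lemma fst_fresh [simp]: "fst (fresh ts r) = r"
  by (simp add: fresh_def)

text \<open>The \<open>LEAST\<close> is attained: a sort has infinitely many variables, a list only
  finitely many terms.\<close>

lemma fresh_notin: "TVar (fresh ts r) \<notin> set ts"
proof -
  have "inj (\<lambda>m. TVar (r, m) :: (nat, 'a) tm)"
    by (auto intro: injI)
  then have "\<not> range (\<lambda>m. TVar (r, m)) \<subseteq> set ts"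
    using finite_imageD finite_subset by blast
  then show ?thesis
    unfolding fresh_def using LeastI_ex[of "\<lambda>m. TVar (r, m) \<notin> set ts"] by auto
qed

lemma restrict_model_restrict_model:
  "j \<le> k \<Longrightarrow> restrict_model (restrict_model M k) j = restrict_model M j"
  unfolding restrict_model_def[of _ j] by (simp add: Dk_restrict_model)
    (auto simp: restrict_model_def fun_eq_iff)

lemma length_Dk:
  assumes "layered_model n \<Delta> M" "k \<le> n" "ws \<in> Dk M k"
  shows "length ws = Suc k"
  using list_all2_lengthD[OF Dk_in_carriers[OF assms]] by simp

text \<open>Projections compose. This admits the shortened tuple both as an argument of
  \<open>ValP\<close> and as a point of level \<open>k - 1\<close>.\<close>

lemma butlast_in_Dpred:
  assumes "layered_model n \<Delta> M" "k \<le> n" "ws \<in> Dk M k"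
  shows "butlast ws \<in> Dpred M k"
proof -
  have "length ws = Suc k"
    using length_Dk[OF assms] .
  moreover obtain us where "us \<in> Dom M" "ws = take (Suc k) us"
    using assms(3) by (auto simp: Dk_def restr_def)
  ultimately show ?thesis
    by (auto simp: Dpred_def Dk_def restr_def butlast_conv_take min_def)
qed

lemma tm_val_cong: "(\<And>x. t = TVar x \<Longrightarrow> e x = e' x) \<Longrightarrow> tm_val \<AA> e t = tm_val \<AA> e' t"
  by (cases t) auto

text \<open>The statement is generalized for the induction: arbitrary terms replace the variables, and
  the structure is that of a fixed level \<open>K\<close>, because passing to \<open>B\<^sub>k\<^sub>-\<^sub>1\<close> restricts the model
  on the modal side only.\<close>

lemma sat_iff_fo_sat_ST:
  assumes "layered_model n \<Delta> M" "K \<le> n" "k \<le> K" "fm \<Delta> k \<phi>" "ws \<in> Dk M k"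
    and "map (tm_val (star (restrict_model M K)) e) ts = ws"
  shows "sat \<Delta> k (restrict_model M k) ws \<phi> \<longleftrightarrow>
    fo_sat (star (restrict_model M K)) e (ST \<Delta> k ts \<phi>)"
  using assms
proof (induction \<Delta> k ts \<phi> arbitrary: e ws rule: ST.induct)
  case (1 \<Delta> k ts \<phi>)
  note M = \<open>layered_model n \<Delta> M\<close> and ws = \<open>ws \<in> Dk M k\<close>
  let ?A = "star (restrict_model M K)"
  have val: "map (tm_val ?A e) ts = ws" and fm: "fm \<Delta> k \<phi>" and "k \<le> K" "k \<le> n"
    using 1 by auto
  have len: "length ws = Suc k" "length ts = Suc k"
    using length_Dk[OF M \<open>k \<le> n\<close> ws] val by auto
  then have nonempty: "ws \<noteq> []" "ts \<noteq> []"
    by auto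
  have pred: "butlast ws \<in> Dpred M k"
    using butlast_in_Dpred[OF M \<open>k \<le> n\<close> ws] .
  have last: "tm_val ?A e (last ts) = last ws"
    using val nonempty by (auto simp: last_map)
  have butlast: "map (tm_val ?A e) (butlast ts) = butlast ws"
    using val by (simp add: map_butlast)
  have A: "PredInt ?A (SymD k) = Dk M k"
    "PredInt ?A (SymR k) = {us @ vs | us vs. (us, vs) \<in> Rel M k}"
    "PredInt ?A (SymP k p) = {ws @ [w] | ws w. ws \<in> Dpred M k \<and> w \<in> ValP M k p ws}"
    "ConstInt ?A (k, i) = ValN M k i"
    for p i
    using \<open>k \<le> K\<close> Dk_restrict_model[OF \<open>k \<le> K\<close>, of M] Dpred_restrict_model[OF \<open>k \<le> K\<close>, of M]
    by (auto simp: star_def restrict_model_def)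
  have carrier: "Carrier ?A r = Wld M r" if "r \<le> k" for r
    using that \<open>k \<le> K\<close> by (simp add: star_def restrict_model_def)
  have N: "Dk (restrict_model M k) k = Dk M k" "Rel (restrict_model M k) k = Rel M k"
    "ValP (restrict_model M k) k = ValP M k" "ValN (restrict_model M k) k = ValN M k"
    by (simp_all add: Dk_restrict_model) (simp_all add: restrict_model_def)
  show ?case
  proof (cases "0 < k \<and> basic \<Delta> (k - 1) \<phi>")
    case True
    have "butlast ws \<in> Dk M (k - 1)"
      using pred True by (simp add: Dpred_def)
    then have "sat \<Delta> (k - 1) (restrict_model M (k - 1)) (butlast ws) \<phi> \<longleftrightarrow>
        fo_sat ?A e (ST \<Delta> (k - 1) (butlast ts) \<phi>)"
      using True \<open>k \<le> K\<close> by (intro 1(1)[OF True M \<open>K \<le> n\<close> _ _ _ butlast]) (auto intro: basic_imp_fm)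
    then show ?thesis
      using True
      by (subst sat.simps, subst ST.simps) (simp add: restrict_model_restrict_model)
  next
    case False
    have lev: "case \<phi> of Nom i \<Rightarrow> i \<in> Noms \<Delta> k | Prp p \<Rightarrow> p \<in> Props \<Delta> k
      | Neg \<psi> \<Rightarrow> fm \<Delta> k \<psi> | Conj \<psi> \<chi> \<Rightarrow> fm \<Delta> k \<psi> \<and> fm \<Delta> k \<chi>
      | At i \<psi> \<Rightarrow> i \<in> Noms \<Delta> k \<and> fm \<Delta> k \<psi> | Dia j \<psi> \<Rightarrow> j = k \<and> fm \<Delta> k \<psi>"
      using fm_not_basic_cases[OF fm False] .
    show ?thesis
    proof (cases \<phi>)
      case (Nom i)
      \<comment> \<open>\<open>sat\<close> also asks for membership in \<open>Dk\<close>, which the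
        equation alone must yield: the tuple is then \<open>ws\<close> itself.\<close>
      have "butlast ws @ [ValN M k i] \<in> Dk M k" if "last ws = ValN M k i"
        using ws that nonempty by (metis append_butlast_last_id)
      then show ?thesis
        using False Nom
        by (subst sat.simps, subst ST.simps) (auto simp: N A last)
    next
      case (Prp p)
      have "ws \<in> {us @ [w] | us w. us \<in> Dpred M k \<and> w \<in> ValP M k p us} \<longleftrightarrow>
          last ws \<in> ValP M k p (butlast ws)"
        using pred nonempty by (auto intro!: exI[of _ "butlast ws"] exI[of _ "last ws"])
      then show ?thesis
        using False Prp
        by (subst sat.simps, subst ST.simps) (auto simp: N A val)
    next
      case (Neg \<psi>)
      then have "sat \<Delta> k (restrict_model M k) ws \<psi> \<longleftrightarrow> fo_sat ?A e (ST \<Delta> k ts \<psi>)"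
        using 1(2)[OF False Neg M \<open>K \<le> n\<close> \<open>k \<le> K\<close> _ ws val] lev by simp
      then show ?thesis
        using False Neg by (subst sat.simps, subst ST.simps) auto
    next
      case (Conj \<psi> \<chi>)
      then have "sat \<Delta> k (restrict_model M k) ws \<psi> \<longleftrightarrow> fo_sat ?A e (ST \<Delta> k ts \<psi>)"
        "sat \<Delta> k (restrict_model M k) ws \<chi> \<longleftrightarrow> fo_sat ?A e (ST \<Delta> k ts \<chi>)"
        using 1(3)[OF False Conj M \<open>K \<le> n\<close> \<open>k \<le> K\<close> _ ws val]
          1(4)[OF False Conj M \<open>K \<le> n\<close> \<open>k \<le> K\<close> _ ws val] lev by simp_all
      then show ?thesis
        using False Conj by (subst sat.simps, subst ST.simps) auto
    next
      case (At i \<psi>)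
      let ?us = "butlast ts @ [TConst (k, i)]"
      let ?vs = "butlast ws @ [ValN M k i]"
      have us: "map (tm_val ?A e) ?us = ?vs"
        by (simp add: butlast A)
      \<comment> \<open>The induction hypothesis covers only tuples in \<open>Dk M k\<close>; both
        sides assert this membership as a conjunct.\<close>
      have "sat \<Delta> k (restrict_model M k) ?vs \<psi> \<longleftrightarrow> fo_sat ?A e (ST \<Delta> k ?us \<psi>)"
        if "?vs \<in> Dk M k"
        using 1(5)[OF False At refl M \<open>K \<le> n\<close> \<open>k \<le> K\<close> _ that us] lev At by simp
      then show ?thesis
        using False At us by (subst sat.simps, subst ST.simps) (auto simp: Let_def N A)
    next
      case (Dia j \<psi>)
      let ?ys = "map (fresh ts) [0..<Suc k]"
      let ?us = "map TVar ?ys :: (nat, nat \<times> 'a) tm list"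
      have IH: "sat \<Delta> k (restrict_model M k) vs \<psi> \<longleftrightarrow> fo_sat ?A e' (ST \<Delta> k ?us \<psi>)"
        if "vs \<in> Dk M k" "map e' ?ys = vs" for vs e'
        using 1(6)[OF False Dia refl refl M \<open>K \<le> n\<close> \<open>k \<le> K\<close> _ that(1)] that(2) lev Dia
        by (simp add: comp_def del: upt_Suc)
      have RelD: "us \<in> Dk M k \<and> vs \<in> Dk M k" if "(us, vs) \<in> Rel M k" for us vs
        using M that \<open>k \<le> n\<close> unfolding layered_model_def by blast
      have val': "map (tm_val ?A e') ts = ws" if "\<forall>x. x \<notin> set ?ys \<longrightarrow> e' x = e x" for e'
      proof -
        have "x \<notin> set ?ys" if "TVar x \<in> set ts" for x
          using that fresh_notin[of ts] by (metis imageE set_map)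
        then have "tm_val ?A e' t = tm_val ?A e t" if "t \<in> set ts" for t
          using that \<open>\<forall>x. x \<notin> set ?ys \<longrightarrow> e' x = e x\<close> by (intro tm_val_cong) blast
        then show ?thesis
          using val by auto
      qed
      \<comment> \<open>A concatenation determines the pair, since the first component has fixed
        length \<open>Suc k\<close>.\<close>
      have R: "us @ vs \<in> PredInt ?A (SymR k) \<longleftrightarrow> (us, vs) \<in> Rel M k"
        if "length us = Suc k" for us vs
        using that RelD length_Dk[OF M \<open>k \<le> n\<close>] by (fastforce simp: A)
      have us: "map (tm_val ?A e') ?us = map e' ?ys" for e'
        by simp
      let ?body = "FAnd (Pred (SymD k) ?us) (FAnd (Pred (SymR k) (ts @ ?us)) (ST \<Delta> k ?us \<psi>))"
      have body: "fo_sat ?A e' ?body \<longleftrightarrow>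
          (ws, map e' ?ys) \<in> Rel M k \<and> sat \<Delta> k (restrict_model M k) (map e' ?ys) \<psi>"
        if "\<forall>x. x \<notin> set ?ys \<longrightarrow> e' x = e x" for e'
        using IH[OF _ refl, of e'] RelD[of ws "map e' ?ys"] R[OF len(1), of "map e' ?ys"]
        unfolding fo_sat.simps map_append val'[OF that] us A(1) by blast
      have "(\<exists>vs. (ws, vs) \<in> Rel M k \<and> sat \<Delta> k (restrict_model M k) vs \<psi>) \<longleftrightarrow>
          fo_sat ?A e (foldr FEx ?ys ?body)" (is "?L \<longleftrightarrow> ?R")
      proof
        assume ?L
        then obtain vs where vs: "(ws, vs) \<in> Rel M k" "sat \<Delta> k (restrict_model M k) vs \<psi>"
          by blast
        have vsW: "list_all2 (\<lambda>a s. a \<in> Wld M s) vs [0..<Suc k]"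
          using Dk_in_carriers[OF M \<open>k \<le> n\<close>] RelD[OF vs(1)] by blast
        \<comment> \<open>Each sort has exactly one variable in \<open>?ys\<close>, so the sort
          serves as the coordinate index.\<close>
        define e' where "e' x = (if x \<in> set ?ys then vs ! fst x else e x)" for x
        have "map e' ?ys = vs"
          using list_all2_lengthD[OF vsW]
          by (intro nth_equalityI) (auto simp: e'_def simp del: upt_Suc)
        moreover have "e' y \<in> Carrier ?A (fst y)" if "y \<in> set ?ys" for y
          using that list_all2_nthD2[OF vsW, of "fst y"]
          by (auto simp: e'_def carrier simp del: upt_Suc)
        moreover have e'_eq: "\<forall>x. x \<notin> set ?ys \<longrightarrow> e' x = e x"
          by (simp add: e'_def)
        ultimately show ?R
          unfolding fo_sat_foldr_FEx using vs body[OF e'_eq] by (intro exI[of _ e']) blast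
      next
        assume ?R
        then show ?L
          unfolding fo_sat_foldr_FEx using body by blast
      qed
      then show ?thesis
        using False Dia by (subst sat.simps, subst ST.simps) (simp only: Let_def lfm.case if_False N)
    qed
  qed
qed

theorem theorem1:
  fixes n k :: nat
    and \<Delta> :: "'s lsig"
    and M :: "('s, 'w) lmodel"
    and \<phi> :: "'s lfm"
    and ws :: "'w list"
    and xs :: "nat var list"
    and e :: "nat var \<Rightarrow> 'w"
  assumes "layered_signature n \<Delta>"
    and "layered_model n \<Delta> M"
    and "k \<le> n"
    and "fm \<Delta> k \<phi>"
    and "ws \<in> Dk M k"
    and "distinct xs" and "map fst xs = [0..<Suc k]"
    and "fo_assignment (Sigma_sig \<Delta> k) (star (restrict_model M k)) e"
    and "\<forall>r\<le>k. e (xs ! r) = ws ! r"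
  shows "sat \<Delta> k (restrict_model M k) ws \<phi> \<longleftrightarrow>
    fo_sat (star (restrict_model M k)) e (ST \<Delta> k (map TVar xs) \<phi>)"
proof (rule sat_iff_fo_sat_ST[OF assms(2,3) order.refl assms(4,5)])
  \<comment> \<open>With \<open>K = k\<close>, it remains to see that the variables
    \<open>xs\<close> evaluate to \<open>ws\<close>.\<close>
  have "length xs = Suc k"
    using assms(7) by (metis diff_zero length_map length_upt)
  moreover have "length ws = Suc k"
    using length_Dk[OF assms(2,3,5)] .
  ultimately show "map (tm_val (star (restrict_model M k)) e) (map TVar xs) = ws"
    using assms(9) by (intro nth_equalityI) auto
qed

end
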